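(* Let $a=p/q$ with $p,q\in\mathbb{N}$ (positive integers), and let $m\ge2$ be an even integer. Then there exists a constant $C>0$ such that $$\left|K_{p/q}^m(x,y)\right|\le C\,(1+|x||y|)^{\frac{3mp}{2}-m+2}\qquad\text{for all }x,y\in\mathbb{R}^m,$$ where $K_a^m$ is the radially deformed Fourier kernel (see context).
   Context: For an integer $m\ge2$ put $\lambda=(m-2)/2$. Let $a>0$. For $x,y\in\mathbb{R}^m\setminus\{0\}$ put $z=|x||y|$, $\xi=\langle x,y\rangle/z=\cos\theta$ with $\theta\in[0,\pi]$. For $m\ge3$ the radially deformed Fourier kernel is $$K_a^m(x,y)=a^{2\lambda/a}\,\Gamma\left(\frac{2\lambda+a}{a}\right)\sum_{k=0}^{\infty}e^{-\frac{i\pi k}{a}}\frac{\lambda+k}{\lambda}z^{-\lambda}J_{\frac{2(k+\lambda)}{a}}\left(\frac{2}{a}z^{a/2}\right)C_k^{(\lambda)}(\xi),$$ and for $m=2$ it is the limit $\lambda\to0$ of this expression, namely $$K_a^2(x,y)=J_0(z_a)+2\sum_{k=1}^{\infty}e^{-\frac{i\pi k}{a}}J_{\frac{2k}{a}}(z_a)\cos k\theta,\qquad z_a=\frac2a z^{a/2}.$$ Here $J_\nu$ is the Bessel function of the first kind and $C_k^{(\lambda)}$ is the Gegenbauer polynomial. If $x=0$ or $y=0$ the kernel is defined by continuity and equals $1$. *)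

theory Defs
  imports "HOL-Analysis.Analysis"
begin

(* Bessel function of the first kind of real order, by its power series.  Meant for x > 0:
   because 0 powr 0 = 0, the formula does not give J_0(0) = 1 at x = 0.
   The factor 1 / Gamma is the entire function rGamma. *)
definition Bessel_J :: "real \<Rightarrow> real \<Rightarrow> real" where
  "Bessel_J \<nu> x =
     (\<Sum>j. (-1) ^ j / fact j * rGamma (real j + \<nu> + 1) * (x / 2) powr (2 * real j + \<nu>))"

definition Gegenbauer :: "nat \<Rightarrow> real \<Rightarrow> real \<Rightarrow> real" where
  "Gegenbauer k l t =
     (\<Sum>j\<le>k div 2. (-1) ^ j * pochhammer l (k - j) / (fact j * fact (k - 2 * j))
        * (2 * t) ^ (k - 2 * j))"

(* The kernel on R^m with m = CARD('n).  The parameter lambda = (m - 2) / 2 vanishes for m = 2,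
   where the general series (which divides by lambda) is replaced by its limit.
   The value 1 at x = 0 or y = 0 is the continuous extension. *)
definition deformed_Fourier_kernel :: "real \<Rightarrow> real ^ 'n \<Rightarrow> real ^ 'n \<Rightarrow> complex" where
  "deformed_Fourier_kernel a x y =
    (let l = (real CARD('n) - 2) / 2;
         z = norm x * norm y;
         \<xi> = (x \<bullet> y) / z;
         \<theta> = arccos \<xi>;
         w = 2 / a * z powr (a / 2)
     in if x = 0 \<or> y = 0 then 1
        else if CARD('n) = 2 then
          of_real (Bessel_J 0 w)
          + 2 * (\<Sum>k. exp (- (\<i> * pi * real (Suc k) / a))
                  * of_real (Bessel_J (2 * real (Suc k) / a) w * cos (real (Suc k) * \<theta>)))
        else
          of_real (a powr (2 * l / a) * Gamma ((2 * l + a) / a))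
          * (\<Sum>k. exp (- (\<i> * pi * real k / a))
               * of_real ((l + real k) / l * z powr (- l)
                   * Bessel_J (2 * (real k + l) / a) w * Gegenbauer k l \<xi>)))"

end

theory Submission
  imports Defs "HOL-Real_Asymp.Real_Asymp"
begin

text \<open>The angular part of the kernel is harmless: for even \<open>m\<close> the number \<open>\<lambda> = (m - 2) / 2\<close> is an integer,
and a Gegenbauer polynomial of degree \<open>k\<close> with such a parameter is at most of order
\<open>k\<^bsup>2\<lambda>-1\<^esup>\<close> on \<open>[-1, 1]\<close> (\<open>Gegenbauer_bound\<close>). Since the phases have absolute value \<open>1\<close>, this and the factor
\<open>(\<lambda> + k) / \<lambda>\<close> reduce the claim to an estimate of
\<open>z\<^bsup>-\<lambda>\<^esup> \<Sum>k. (k + 1)\<^bsup>m-2\<^esup> \<bar>J\<^bsub>2(k+\<lambda>)/a\<^esub>(w)\<bar>\<close> with \<open>w = (2/a) z\<^bsup>a/2\<^esup>\<close>.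

What is needed is control of \<open>J\<^sub>\<nu>(w)\<close> that is uniform in the real order \<open>\<nu> \<ge> 0\<close>. It comes from an energy
argument: for \<open>\<mu> \<ge> 0\<close> the function \<open>w\<^bsup>-2\<mu>\<^esup> (J\<^sub>\<mu>\<^sup>2 / 2 + \<Sum>n\<ge>1. J\<^bsub>\<mu>+n\<^esub>\<^sup>2)\<close> is nonincreasing, because the contiguous
relations make its derivative telescope up to terms of one sign. Its value at \<open>0\<close> is explicit, and
this bounds all \<open>J\<^bsub>\<mu>+n\<^esub>(w)\<close> by a multiple of \<open>w\<^sup>\<mu>\<close>; with \<open>\<mu>\<close> the fractional part of \<open>\<nu>\<close> the result is
\<open>\<bar>J\<^sub>\<nu>(w)\<bar> \<le> M w\<close> for \<open>w \<ge> 1\<close> (\<open>bessel_clifford_energy\<close>, \<open>Bessel_J_linear_bound\<close>).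
The three-term recurrence in the order, used \<open>r\<close> times, improves this to
\<open>\<bar>J\<^sub>\<nu>(w)\<bar> \<le> C w\<^bsup>r+1\<^esup> / (1 + \<nu>)\<^sup>r\<close> (\<open>Bessel_J_order_decay\<close>).

With \<open>r = m\<close> the series over \<open>k\<close> converges and is of order \<open>w\<^bsup>m+1\<^esup>\<close>, so for large \<open>z\<close> the kernel is at most of
order \<open>z\<close> to the power \<open>a(m+1)/2 - (m-2)/2\<close>. For small \<open>z\<close> the power series shows that
\<open>J\<^bsub>2(k+\<lambda>)/a\<^esub>(w)\<close> contains the factor \<open>z\<^sup>\<lambda>\<close>, which compensates \<open>z\<^bsup>-\<lambda>\<^esup>\<close> (\<open>Bessel_J_series_bound\<close>).
Since \<open>a = p/q \<le> p\<close>, the exponent for large \<open>z\<close> does not exceed the claimed one.\<close>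

section \<open>The Bessel-Clifford function\<close>

text \<open>The entire function \<open>B\<^sub>\<nu>(s) = \<Sum>j. (-s)\<^sup>j / (j! \<Gamma>(j + \<nu> + 1))\<close> satisfies
\<open>J\<^sub>\<nu>(w) = (w/2)\<^sup>\<nu> B\<^sub>\<nu>(w\<^sup>2/4)\<close>. Working with it removes the non-integer power of the argument,
so that differentiation and initial values at \<open>s = 0\<close> present no difficulty.\<close>
definition bessel_clifford_coeff :: "real \<Rightarrow> nat \<Rightarrow> real" where
  "bessel_clifford_coeff \<nu> j = (-1) ^ j / fact j * rGamma (real j + \<nu> + 1)"

definition bessel_clifford :: "real \<Rightarrow> real \<Rightarrow> real" where
  "bessel_clifford \<nu> s = (\<Sum>j. bessel_clifford_coeff \<nu> j * s ^ j)"

lemma rGamma_pos_real: "0 < x \<Longrightarrow> 0 < rGamma (x :: real)"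
  using Gamma_real_pos[of x] by (simp add: rGamma_inverse_Gamma)

text \<open>By the functional equation the quotient \<open>\<Gamma>(j + \<nu> + 1) / \<Gamma>(\<nu> + 1)\<close> is the product of the factors
\<open>\<nu> + i\<close> for \<open>i = 1, \<dots>, j\<close>, each of which is at least \<open>i\<close>.\<close>
lemma fact_mult_rGamma_le:
  assumes "0 \<le> (\<nu>::real)"
  shows "fact j * rGamma (real j + \<nu> + 1) \<le> rGamma (\<nu> + 1)"
proof (induction j)
  case (Suc j)
  have pos: "0 < rGamma (real j + \<nu> + 1 + 1)"
    using assms by (intro rGamma_pos_real) auto
  have "real (Suc j) * rGamma (real j + \<nu> + 1 + 1) \<le> (real j + \<nu> + 1) * rGamma (real j + \<nu> + 1 + 1)"
    using assms pos by (intro mult_right_mono) auto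
  also have "\<dots> = rGamma (real j + \<nu> + 1)"
    by (rule rGamma_plus1)
  finally have "fact j * (real (Suc j) * rGamma (real j + \<nu> + 1 + 1)) \<le> fact j * rGamma (real j + \<nu> + 1)"
    by (intro mult_left_mono) auto
  with Suc show ?case by (simp add: algebra_simps)
qed simp

lemma rGamma_shift_le:
  assumes "0 \<le> (\<nu>::real)"
  shows "rGamma (real j + \<nu> + 1) \<le> rGamma (\<nu> + 1)"
proof -
  have "1 * rGamma (real j + \<nu> + 1) \<le> fact j * rGamma (real j + \<nu> + 1)"
    using assms rGamma_pos_real[of "real j + \<nu> + 1"] by (intro mult_right_mono) auto
  with fact_mult_rGamma_le[OF assms, of j] show ?thesis by simp
qed

text \<open>Shifting the argument down by an integer only increases \<open>1 / \<Gamma>\<close>, which leaves the compact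
interval \<open>[1, 2]\<close>. This makes the constants below independent of the order.\<close>
lemma rGamma_bounded:
  "\<exists>M>0. \<forall>\<nu>\<ge>0. rGamma (\<nu> + 1 :: real) \<le> M"
proof -
  have "compact (rGamma ` {1..2::real})"
    by (intro compact_continuous_image continuous_intros) auto
  then obtain M where M: "\<And>x. x \<in> {1..2} \<Longrightarrow> norm (rGamma (x::real)) \<le> M"
    using compact_imp_bounded bounded_iff by (metis (no_types, lifting) imageI)
  have "rGamma (\<nu> + 1) \<le> max M 1" if "0 \<le> \<nu>" for \<nu> :: real
  proof -
    have "rGamma (\<nu> + 1) = rGamma (real (nat \<lfloor>\<nu>\<rfloor>) + frac \<nu> + 1)"
      using that by (simp add: frac_def)
    also have "\<dots> \<le> rGamma (frac \<nu> + 1)"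
      by (intro rGamma_shift_le) simp
    also have "\<dots> \<le> M"
      using M[of "frac \<nu> + 1"] frac_lt_1[of \<nu>] frac_ge_0[of \<nu>] by simp
    finally show ?thesis by simp
  qed
  then show ?thesis by (intro exI[of _ "max M 1"]) auto
qed

lemma abs_bessel_clifford_term_le:
  assumes "0 \<le> \<nu>"
  shows "\<bar>bessel_clifford_coeff \<nu> j * s ^ j\<bar> \<le> rGamma (\<nu> + 1) * (\<bar>s\<bar> ^ j /\<^sub>R fact j)"
proof -
  have "\<bar>bessel_clifford_coeff \<nu> j * s ^ j\<bar> = rGamma (real j + \<nu> + 1) * (\<bar>s\<bar> ^ j /\<^sub>R fact j)"
    using assms rGamma_pos_real[of "real j + \<nu> + 1"]
    by (simp add: bessel_clifford_coeff_def abs_mult power_abs divide_simps)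
  also have "\<dots> \<le> rGamma (\<nu> + 1) * (\<bar>s\<bar> ^ j /\<^sub>R fact j)"
    using assms by (intro mult_right_mono rGamma_shift_le) auto
  finally show ?thesis .
qed

lemma summable_bessel_clifford_abs:
  assumes "0 \<le> \<nu>"
  shows "summable (\<lambda>j. \<bar>bessel_clifford_coeff \<nu> j * s ^ j\<bar>)"
  by (rule summable_comparison_test'[OF summable_mult[OF summable_exp_generic[of "\<bar>s\<bar>"]], of 0])
     (use abs_bessel_clifford_term_le[OF assms] in auto)

lemma summable_bessel_clifford:
  assumes "0 \<le> \<nu>"
  shows "summable (\<lambda>j. bessel_clifford_coeff \<nu> j * s ^ j)"
  using summable_bessel_clifford_abs[OF assms] by (rule summable_rabs_cancel)

lemma abs_bessel_clifford_le:
  assumes "0 \<le> \<nu>"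
  shows "\<bar>bessel_clifford \<nu> s\<bar> \<le> rGamma (\<nu> + 1) * exp \<bar>s\<bar>"
proof -
  have "\<bar>bessel_clifford \<nu> s\<bar> \<le> (\<Sum>j. \<bar>bessel_clifford_coeff \<nu> j * s ^ j\<bar>)"
    unfolding bessel_clifford_def by (rule summable_rabs[OF summable_bessel_clifford_abs[OF assms]])
  also have "\<dots> \<le> (\<Sum>j. rGamma (\<nu> + 1) * (\<bar>s\<bar> ^ j /\<^sub>R fact j))"
    by (intro suminf_le abs_bessel_clifford_term_le summable_bessel_clifford_abs assms
          summable_mult summable_exp_generic)
  also have "\<dots> = rGamma (\<nu> + 1) * exp \<bar>s\<bar>"
    unfolding exp_def by (intro suminf_mult summable_exp_generic)
  finally show ?thesis .
qed

lemma bessel_clifford_0: "bessel_clifford \<nu> 0 = rGamma (\<nu> + 1)"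
  unfolding bessel_clifford_def powser_zero by (simp add: bessel_clifford_coeff_def)

lemma bessel_clifford_coeff_Suc:
  "real (Suc j) * bessel_clifford_coeff \<nu> (Suc j) = - bessel_clifford_coeff (\<nu> + 1) j"
proof -
  have "real (Suc j) * ((-1) ^ Suc j / fact (Suc j)) = - ((-1) ^ j / fact j :: real)"
    by (simp del: of_nat_Suc)
  moreover have "real (Suc j) + \<nu> + 1 = real j + (\<nu> + 1) + 1"
    by simp
  ultimately show ?thesis
    unfolding bessel_clifford_coeff_def by (metis mult.assoc mult_minus_left)
qed

lemma DERIV_bessel_clifford:
  assumes "0 \<le> \<nu>"
  shows "(bessel_clifford \<nu> has_real_derivative - bessel_clifford (\<nu> + 1) s) (at s)"
proof -
  have "diffs (bessel_clifford_coeff \<nu>) j = - bessel_clifford_coeff (\<nu> + 1) j" for j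
    unfolding diffs_def by (rule bessel_clifford_coeff_Suc)
  then have "(\<Sum>j. diffs (bessel_clifford_coeff \<nu>) j * s ^ j) = - bessel_clifford (\<nu> + 1) s"
    using summable_bessel_clifford[of "\<nu> + 1" s] assms
    by (simp add: bessel_clifford_def suminf_minus)
  with termdiffs_strong_converges_everywhere[OF summable_bessel_clifford[OF assms], of s]
  show ?thesis by (simp add: bessel_clifford_def [abs_def])
qed

text \<open>Comparison of coefficients: \<open>1 / \<Gamma>(j + \<nu> + 1) = (j + \<nu> + 1) / \<Gamma>(j + \<nu> + 2)\<close>, where the part
\<open>\<nu> + 1\<close> of the factor gives the first term on the right and the part \<open>j\<close>, which cancels against
\<open>j!\<close>, gives the second one.\<close>
lemma bessel_clifford_recurrence:
  assumes "0 \<le> \<nu>"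
  shows "bessel_clifford \<nu> s = (\<nu> + 1) * bessel_clifford (\<nu> + 1) s - s * bessel_clifford (\<nu> + 2) s"
proof -
  let ?c = bessel_clifford_coeff
  have sums: "(\<lambda>j. ?c \<mu> j * s ^ j) sums bessel_clifford \<mu> s" if "0 \<le> \<mu>" for \<mu>
    unfolding bessel_clifford_def by (rule summable_sums[OF summable_bessel_clifford[OF that]])
  have "(\<lambda>j. s * (?c (\<nu> + 2) j * s ^ j)) sums (s * bessel_clifford (\<nu> + 2) s)"
    using assms by (intro sums_mult sums) auto
  moreover have "s * (?c (\<nu> + 2) j * s ^ j) = - (real (Suc j) * ?c (\<nu> + 1) (Suc j) * s ^ Suc j)" for j
    unfolding bessel_clifford_coeff_Suc by (simp add: add.assoc)
  ultimately have "(\<lambda>j. - (real (Suc j) * ?c (\<nu> + 1) (Suc j) * s ^ Suc j)) sums (s * bessel_clifford (\<nu> + 2) s)"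
    by simp
  then have "(\<lambda>j. - (real j * ?c (\<nu> + 1) j * s ^ j)) sums (s * bessel_clifford (\<nu> + 2) s)"
    by (subst (asm) sums_Suc_iff) simp
  then have "(\<lambda>j. (\<nu> + 1) * (?c (\<nu> + 1) j * s ^ j) - - (real j * ?c (\<nu> + 1) j * s ^ j))
      sums ((\<nu> + 1) * bessel_clifford (\<nu> + 1) s - s * bessel_clifford (\<nu> + 2) s)"
    using assms by (intro sums_diff sums_mult sums) auto
  moreover have "(\<nu> + 1) * (?c (\<nu> + 1) j * s ^ j) - - (real j * ?c (\<nu> + 1) j * s ^ j) = ?c \<nu> j * s ^ j" for j
  proof -
    have "?c \<nu> j = (-1) ^ j / fact j * ((real j + \<nu> + 1) * rGamma (real j + \<nu> + 1 + 1))"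
      by (simp only: rGamma_plus1 bessel_clifford_coeff_def)
    also have "\<dots> = (real j + \<nu> + 1) * ?c (\<nu> + 1) j"
      by (simp add: bessel_clifford_coeff_def add_ac)
    finally show ?thesis by (simp only: algebra_simps)
  qed
  ultimately have "(\<lambda>j. ?c \<nu> j * s ^ j)
      sums ((\<nu> + 1) * bessel_clifford (\<nu> + 1) s - s * bessel_clifford (\<nu> + 2) s)"
    by simp
  with sums[OF assms] show ?thesis by (rule sums_unique2)
qed

text \<open>The key estimate, uniform in \<open>n\<close>. With \<open>b\<^sub>k = B\<^bsub>\<mu>+k\<^esub>\<close>, the energy
\<open>H\<^sub>N = b\<^sub>0\<^sup>2 / 2 + \<Sum>k=1..N. s\<^sup>k b\<^sub>k\<^sup>2\<close> has a derivative that telescopes by the recurrence: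
\<open>H\<^sub>N' = - s\<^sup>N b\<^sub>N b\<^bsub>N+1\<^esub> - \<mu> \<Sum>k=1..N. s\<^bsup>k-1\<^esup> b\<^sub>k\<^sup>2\<close>. The last sum has a favourable sign and the
boundary term tends to \<open>0\<close> uniformly on bounded intervals as \<open>N\<close> grows, so no term can exceed
what the initial value \<open>H\<^sub>N(0) = 1 / (2 \<Gamma>(\<mu> + 1)\<^sup>2)\<close> permits. For \<open>\<mu> = 0\<close> this is the classical
inequality \<open>J\<^sub>0\<^sup>2 + 2 \<Sum>k=1..N. J\<^sub>k\<^sup>2 \<le> 1\<close> in the limit of large \<open>N\<close>.\<close>
lemma bessel_clifford_energy:
  fixes \<mu> s :: real
  assumes "0 \<le> \<mu>" "0 \<le> s"
  shows "s ^ n * (bessel_clifford (\<mu> + real n) s)\<^sup>2 \<le> (rGamma (\<mu> + 1))\<^sup>2"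
proof -
  define b where "b k = bessel_clifford (\<mu> + real k)" for k
  define R where "R = rGamma (\<mu> + 1)"
  have R: "0 < R" unfolding R_def using assms by (intro rGamma_pos_real) auto
  define H where "H N t = (b 0 t)\<^sup>2 / 2 + (\<Sum>k<N. t ^ Suc k * (b (Suc k) t)\<^sup>2)" for N t
  have deriv_b: "(b k has_real_derivative - b (Suc k) t) (at t)" for k t
    using DERIV_bessel_clifford[of "\<mu> + real k" t] assms by (simp add: b_def [abs_def] algebra_simps)
  have rec: "b k t = (\<mu> + real k + 1) * b (Suc k) t - t * b (Suc (Suc k)) t" for k t
    using bessel_clifford_recurrence[of "\<mu> + real k" t] assms by (simp add: b_def algebra_simps)
  have deriv_H: "(H N has_real_derivative
      - (t ^ N * b N t * b (Suc N) t) - \<mu> * (\<Sum>k<N. t ^ k * (b (Suc k) t)\<^sup>2)) (at t)" for N t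
  proof (induction N)
    case 0
    show ?case unfolding H_def
      by (rule derivative_eq_intros deriv_b | simp)+
  next
    case (Suc N)
    have "H (Suc N) = (\<lambda>t. H N t + t ^ Suc N * (b (Suc N) t)\<^sup>2)"
      by (simp add: H_def fun_eq_iff)
    moreover have "((\<lambda>t. H N t + t ^ Suc N * (b (Suc N) t)\<^sup>2) has_real_derivative
      (- (t ^ N * b N t * b (Suc N) t) - \<mu> * (\<Sum>k<N. t ^ k * (b (Suc k) t)\<^sup>2))
      + (real (Suc N) * t ^ N * (b (Suc N) t)\<^sup>2
         + t ^ Suc N * (2 * b (Suc N) t * (- b (Suc (Suc N)) t)))) (at t)"
      by (rule derivative_eq_intros deriv_b Suc refl | simp)+
    moreover have "(- (t ^ N * b N t * b (Suc N) t) - \<mu> * (\<Sum>k<N. t ^ k * (b (Suc k) t)\<^sup>2))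
      + (real (Suc N) * t ^ N * (b (Suc N) t)\<^sup>2
         + t ^ Suc N * (2 * b (Suc N) t * (- b (Suc (Suc N)) t)))
      = - (t ^ Suc N * b (Suc N) t * b (Suc (Suc N)) t) - \<mu> * (\<Sum>k<Suc N. t ^ k * (b (Suc k) t)\<^sup>2)"
      unfolding rec[of N t] by (simp add: algebra_simps power2_eq_square)
    ultimately show ?case by metis
  qed
  \<comment> \<open>A bound for the boundary term on \<open>[0, s]\<close>; the factorial makes it vanish in the limit.\<close>
  define K where "K N = R\<^sup>2 * (exp s)\<^sup>2 * (s ^ N /\<^sub>R fact N)" for N
  have small: "\<bar>t ^ N * b N t * b (Suc N) t\<bar> \<le> K N" if "0 \<le> t" "t \<le> s" for t N
  proof -
    have "\<bar>b N t\<bar> \<le> rGamma (\<mu> + real N + 1) * exp \<bar>t\<bar>"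
      unfolding b_def using assms by (intro abs_bessel_clifford_le) auto
    also have "\<dots> \<le> (R / fact N) * exp s"
      using fact_mult_rGamma_le[OF assms(1), of N] that R
      by (intro mult_mono) (auto simp: R_def field_simps)
    finally have 1: "\<bar>b N t\<bar> \<le> (R / fact N) * exp s" .
    have "\<bar>b (Suc N) t\<bar> \<le> rGamma (real (Suc N) + \<mu> + 1) * exp \<bar>t\<bar>"
      unfolding b_def add.commute[of "real (Suc N)"] using assms by (intro abs_bessel_clifford_le) auto
    also have "\<dots> \<le> R * exp s"
      unfolding R_def using that assms R by (intro mult_mono rGamma_shift_le) (auto simp: R_def)
    finally have 2: "\<bar>b (Suc N) t\<bar> \<le> R * exp s" .
    have "\<bar>t ^ N * b N t * b (Suc N) t\<bar> = t ^ N * \<bar>b N t\<bar> * \<bar>b (Suc N) t\<bar>"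
      using that by (simp add: abs_mult)
    also have "\<dots> \<le> s ^ N * ((R / fact N) * exp s) * (R * exp s)"
      using 1 2 that assms R by (intro mult_mono power_mono) auto
    also have "\<dots> = K N" by (simp add: K_def power2_eq_square field_simps)
    finally show ?thesis .
  qed
  \<comment> \<open>Up to the slope \<open>K N\<close>, the energy does not increase.\<close>
  have H_le: "H N s \<le> R\<^sup>2 / 2 + s * K N" for N
  proof -
    have "H N s - K N * s \<le> H N 0 - K N * 0"
    proof (rule DERIV_nonpos_imp_nonincreasing[OF assms(2)])
      fix t assume t: "0 \<le> t" "t \<le> s"
      have "((\<lambda>t. H N t - K N * t) has_real_derivative
        (- (t ^ N * b N t * b (Suc N) t) - \<mu> * (\<Sum>k<N. t ^ k * (b (Suc k) t)\<^sup>2)) - K N) (at t)"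
        by (rule derivative_eq_intros deriv_H | simp)+
      moreover have "0 \<le> \<mu> * (\<Sum>k<N. t ^ k * (b (Suc k) t)\<^sup>2)"
        using assms t by (intro mult_nonneg_nonneg sum_nonneg) auto
      ultimately show "\<exists>y. ((\<lambda>t. H N t - K N * t) has_real_derivative y) (at t) \<and> y \<le> 0"
        using small[OF t, of N] by (intro exI conjI) (assumption, linarith)
    qed
    moreover have "H N 0 = R\<^sup>2 / 2"
      by (simp add: H_def b_def bessel_clifford_0 R_def)
    ultimately show ?thesis by (simp add: mult.commute)
  qed
  have "s ^ n * (b n s)\<^sup>2 \<le> R\<^sup>2 + 2 * s * K N" if "n \<le> N" for N
  proof -
    define S where "S = (\<Sum>k<N. s ^ Suc k * (b (Suc k) s)\<^sup>2)"
    have HS: "2 * H N s = (b 0 s)\<^sup>2 + 2 * S"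
      by (simp add: H_def S_def)
    have S: "0 \<le> S"
      unfolding S_def using assms by (intro sum_nonneg) auto
    have "s ^ n * (b n s)\<^sup>2 \<le> 2 * H N s"
    proof (cases n)
      case 0
      then show ?thesis using S by (simp add: HS)
    next
      case (Suc k)
      then have "s ^ n * (b n s)\<^sup>2 \<le> S"
        using that assms member_le_sum[of k "{..<N}" "\<lambda>k. s ^ Suc k * (b (Suc k) s)\<^sup>2"]
        by (simp add: S_def)
      moreover have "0 \<le> (b 0 s)\<^sup>2" by simp
      ultimately show ?thesis using S unfolding HS by linarith
    qed
    with H_le[of N] show ?thesis by simp
  qed
  moreover have "(\<lambda>N. R\<^sup>2 + 2 * s * K N) \<longlonglongrightarrow> R\<^sup>2 + 2 * s * (R\<^sup>2 * (exp s)\<^sup>2 * 0)"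
    unfolding K_def by (intro tendsto_intros summable_LIMSEQ_zero summable_exp_generic)
  ultimately have "s ^ n * (b n s)\<^sup>2 \<le> R\<^sup>2"
    by (intro LIMSEQ_le_const[of "\<lambda>N. R\<^sup>2 + 2 * s * K N"]) auto
  then show ?thesis by (simp add: b_def R_def)
qed

section \<open>Bessel functions: bounds uniform in the order\<close>

lemma Bessel_J_eq_bessel_clifford:
  assumes "0 \<le> \<nu>" "0 < w"
  shows "Bessel_J \<nu> w = (w / 2) powr \<nu> * bessel_clifford \<nu> ((w / 2)\<^sup>2)"
proof -
  have "(w / 2) powr (2 * real j + \<nu>) = (w / 2) powr \<nu> * ((w / 2)\<^sup>2) ^ j" for j
  proof -
    have "(w / 2) powr (2 * real j) = (w / 2) ^ (2 * j)"
      using assms powr_realpow[of "w / 2" "2 * j"] by simp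
    then show ?thesis by (simp add: powr_add power_mult)
  qed
  then have "Bessel_J \<nu> w = (\<Sum>j. (w / 2) powr \<nu> * (bessel_clifford_coeff \<nu> j * ((w / 2)\<^sup>2) ^ j))"
    unfolding Bessel_J_def bessel_clifford_coeff_def by (simp only: mult_ac)
  also have "\<dots> = (w / 2) powr \<nu> * bessel_clifford \<nu> ((w / 2)\<^sup>2)"
    unfolding bessel_clifford_def by (rule suminf_mult[OF summable_bessel_clifford[OF assms(1)]])
  finally show ?thesis .
qed

lemma Bessel_J_recurrence:
  assumes "0 \<le> \<nu>" "0 < w"
  shows "Bessel_J \<nu> w + Bessel_J (\<nu> + 2) w = 2 * (\<nu> + 1) / w * Bessel_J (\<nu> + 1) w"
proof -
  define P where "P = (w / 2) powr \<nu>"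
  define b where "b \<mu> = bessel_clifford \<mu> ((w / 2)\<^sup>2)" for \<mu>
  have J: "Bessel_J \<nu> w = P * b \<nu>" "Bessel_J (\<nu> + 1) w = P * (w / 2) * b (\<nu> + 1)"
    "Bessel_J (\<nu> + 2) w = P * (w / 2)\<^sup>2 * b (\<nu> + 2)"
    using assms by (simp_all add: Bessel_J_eq_bessel_clifford P_def b_def powr_add)
  have rec: "b \<nu> = (\<nu> + 1) * b (\<nu> + 1) - (w / 2)\<^sup>2 * b (\<nu> + 2)"
    unfolding b_def by (rule bessel_clifford_recurrence[OF assms(1)])
  have "2 * (\<nu> + 1) / w * (P * (w / 2) * b (\<nu> + 1)) = P * ((\<nu> + 1) * b (\<nu> + 1))"
    using assms by simp
  then show ?thesis
    unfolding J rec by (simp only: algebra_simps)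
qed

lemma abs_Bessel_J_le_small_argument:
  assumes "0 \<le> \<nu>" "0 < w"
  shows "\<bar>Bessel_J \<nu> w\<bar> \<le> rGamma (\<nu> + 1) * exp ((w / 2)\<^sup>2) * (w / 2) powr \<nu>"
  using mult_left_mono[OF abs_bessel_clifford_le[OF assms(1), of "(w / 2)\<^sup>2"], of "(w / 2) powr \<nu>"] assms
  by (simp add: Bessel_J_eq_bessel_clifford abs_mult mult_ac)

text \<open>The energy estimate in terms of \<open>J\<close>: raising the order by an integer does not spoil the trivial
bound of \<open>J\<^sub>\<mu>\<close> near the origin, which now holds for all arguments.\<close>
lemma abs_Bessel_J_le_shift:
  assumes "0 \<le> \<mu>" "0 < w"
  shows "\<bar>Bessel_J (\<mu> + real n) w\<bar> \<le> rGamma (\<mu> + 1) * (w / 2) powr \<mu>"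
proof -
  define b where "b = bessel_clifford (\<mu> + real n) ((w / 2)\<^sup>2)"
  have "((w / 2) ^ n * b)\<^sup>2 = ((w / 2)\<^sup>2) ^ n * b\<^sup>2"
    by (metis power_mult_distrib power_mult mult.commute)
  also have "\<dots> \<le> (rGamma (\<mu> + 1))\<^sup>2"
    unfolding b_def by (rule bessel_clifford_energy[OF assms(1)]) simp
  finally have "((w / 2) ^ n * b)\<^sup>2 \<le> (rGamma (\<mu> + 1))\<^sup>2" .
  then have "\<bar>(w / 2) ^ n * b\<bar> \<le> rGamma (\<mu> + 1)"
    using rGamma_pos_real[of "\<mu> + 1"] assms by (simp add: abs_le_square_iff[symmetric])
  then have "(w / 2) powr \<mu> * \<bar>(w / 2) ^ n * b\<bar> \<le> (w / 2) powr \<mu> * rGamma (\<mu> + 1)"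
    by (intro mult_left_mono) auto
  moreover have "Bessel_J (\<mu> + real n) w = (w / 2) powr \<mu> * ((w / 2) ^ n * b)"
    using assms by (simp add: Bessel_J_eq_bessel_clifford b_def powr_add powr_realpow)
  ultimately show ?thesis by (simp add: abs_mult mult_ac)
qed

text \<open>Writing \<open>\<nu>\<close> as its fractional part plus an integer, the growth in \<open>w\<close> is governed by the fractional
part alone and is therefore at most linear.\<close>
lemma Bessel_J_linear_bound:
  "\<exists>M>0. \<forall>\<nu>\<ge>0. \<forall>w\<ge>1. \<bar>Bessel_J \<nu> w\<bar> \<le> M * w"
proof -
  obtain M :: real where M: "M > 0" "\<And>\<nu>. 0 \<le> \<nu> \<Longrightarrow> rGamma (\<nu> + 1) \<le> M"
    using rGamma_bounded by blast
  have "\<bar>Bessel_J \<nu> w\<bar> \<le> M * w" if "0 \<le> \<nu>" "1 \<le> w" for \<nu> w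
  proof -
    have "\<bar>Bessel_J \<nu> w\<bar> = \<bar>Bessel_J (frac \<nu> + real (nat \<lfloor>\<nu>\<rfloor>)) w\<bar>"
      using that by (simp add: frac_def)
    also have "\<dots> \<le> rGamma (frac \<nu> + 1) * (w / 2) powr frac \<nu>"
      using that by (intro abs_Bessel_J_le_shift) auto
    also have "\<dots> \<le> M * w"
    proof (intro mult_mono M)
      have "(w / 2) powr frac \<nu> \<le> w powr frac \<nu>"
        using that by (intro powr_mono2) auto
      also have "\<dots> \<le> w powr 1"
        using that frac_lt_1[of \<nu>] by (intro powr_mono) auto
      finally show "(w / 2) powr frac \<nu> \<le> w" using that by simp
    qed (use M that in auto)
    finally show ?thesis .
  qed
  with M(1) show ?thesis by blast
qed

text \<open>The recurrence reads \<open>J\<^sub>\<nu> = (w / 2\<nu>) (J\<^bsub>\<nu>-1\<^esub> + J\<^bsub>\<nu>+1\<^esub>)\<close>, so every application trades a factor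
\<open>1 / \<nu>\<close> for a factor \<open>w\<close>. This gives decay in the order of any polynomial degree without an
analysis of the transition region \<open>\<nu> \<approx> w\<close>.\<close>
lemma Bessel_J_order_decay:
  "\<exists>C>0. \<forall>\<nu>\<ge>0. \<forall>w\<ge>1. (1 + \<nu>) ^ r * \<bar>Bessel_J \<nu> w\<bar> \<le> C * w ^ Suc r"
proof (induction r)
  case 0
  show ?case using Bessel_J_linear_bound by simp
next
  case (Suc r)
  then obtain C where C: "C > 0"
    "\<And>\<nu> w. 0 \<le> \<nu> \<Longrightarrow> 1 \<le> w \<Longrightarrow> (1 + \<nu>) ^ r * \<bar>Bessel_J \<nu> w\<bar> \<le> C * w ^ Suc r"
    by blast
  have "(1 + \<nu>) ^ Suc r * \<bar>Bessel_J \<nu> w\<bar> \<le> ((2 ^ r + 1) * C) * w ^ Suc (Suc r)"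
    if \<nu>: "0 \<le> \<nu>" and w: "1 \<le> w" for \<nu> w
  \<comment> \<open>For \<open>\<nu> < 1\<close> the order \<open>\<nu> - 1\<close> is out of range, but then \<open>1 + \<nu> \<le> 2\<close> and nothing has to be gained.\<close>
  proof (cases "\<nu> < 1")
    case True
    have "(1 + \<nu>) ^ Suc r * \<bar>Bessel_J \<nu> w\<bar> = (1 + \<nu>) * ((1 + \<nu>) ^ r * \<bar>Bessel_J \<nu> w\<bar>)"
      by simp
    also have "\<dots> \<le> (2 ^ r + 1) * (C * w ^ Suc r)"
    proof (rule mult_mono[OF _ C(2)[OF \<nu> w]])
      have "(1::real) \<le> 2 ^ r" by simp
      with True show "1 + \<nu> \<le> 2 ^ r + 1" by linarith
    qed (use \<nu> in auto)
    also have "\<dots> \<le> ((2 ^ r + 1) * C) * w ^ Suc (Suc r)"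
      unfolding mult.assoc using w C by (intro mult_left_mono power_increasing) auto
    finally show ?thesis .
  next
    case False
    define A where "A = \<bar>Bessel_J (\<nu> - 1) w\<bar>"
    define B where "B = \<bar>Bessel_J (\<nu> + 1) w\<bar>"
    have nn: "0 \<le> A" "0 \<le> B" by (auto simp: A_def B_def)
    have "2 * \<nu> / w * Bessel_J \<nu> w = Bessel_J (\<nu> - 1) w + Bessel_J (\<nu> + 1) w"
      using Bessel_J_recurrence[of "\<nu> - 1" w] False w by (simp add: add.commute)
    then have "\<bar>2 * \<nu> / w * Bessel_J \<nu> w\<bar> \<le> A + B"
      unfolding A_def B_def by (metis abs_triangle_ineq)
    then have "2 * \<nu> * \<bar>Bessel_J \<nu> w\<bar> \<le> w * (A + B)"
      using w False by (simp add: abs_mult field_simps)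
    moreover have "(1 + \<nu>) * \<bar>Bessel_J \<nu> w\<bar> \<le> 2 * \<nu> * \<bar>Bessel_J \<nu> w\<bar>"
      using False by (intro mult_right_mono) auto
    ultimately have "(1 + \<nu>) * \<bar>Bessel_J \<nu> w\<bar> \<le> w * (A + B)" by linarith
    then have "(1 + \<nu>) ^ r * ((1 + \<nu>) * \<bar>Bessel_J \<nu> w\<bar>) \<le> (1 + \<nu>) ^ r * (w * (A + B))"
      using \<nu> by (intro mult_left_mono) auto
    also have "\<dots> = w * ((1 + \<nu>) ^ r * A + (1 + \<nu>) ^ r * B)"
      by (simp add: algebra_simps)
    also have "\<dots> \<le> w * (2 ^ r * (C * w ^ Suc r) + C * w ^ Suc r)"
    proof (intro mult_left_mono add_mono)
      have "(1 + \<nu>) ^ r * A \<le> (2 * (1 + (\<nu> - 1))) ^ r * A"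
        using False nn by (intro mult_right_mono power_mono) auto
      also have "\<dots> = 2 ^ r * ((1 + (\<nu> - 1)) ^ r * A)"
        unfolding power_mult_distrib by simp
      also have "\<dots> \<le> 2 ^ r * (C * w ^ Suc r)"
        unfolding A_def using False w by (intro mult_left_mono C) auto
      finally show "(1 + \<nu>) ^ r * A \<le> 2 ^ r * (C * w ^ Suc r)" .
      have "(1 + \<nu>) ^ r * B \<le> (1 + (\<nu> + 1)) ^ r * B"
        using False nn by (intro mult_right_mono power_mono) auto
      also have "\<dots> \<le> C * w ^ Suc r"
        unfolding B_def using \<nu> w by (intro C) auto
      finally show "(1 + \<nu>) ^ r * B \<le> C * w ^ Suc r" .
    qed (use w in auto)
    also have "\<dots> = ((2 ^ r + 1) * C) * w ^ Suc (Suc r)"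
      by (simp add: algebra_simps)
    finally show ?thesis by (simp add: mult_ac)
  qed
  moreover have "(2 ^ r + 1) * C > 0" using C(1) by (simp add: add_pos_pos)
  ultimately show ?case by blast
qed

lemma summable_power_times_geometric:
  fixes \<rho> :: real
  assumes "0 < \<rho>" "\<rho> < 1"
  shows "summable (\<lambda>k. (real k + 1) ^ d * \<rho> ^ k)"
proof (rule summable_comparison_test_bigo)
  show "summable (\<lambda>k. norm (1 / real k ^ 2))"
    using inverse_power_summable[of 2, where 'a=real] by (simp add: inverse_eq_divide)
  show "(\<lambda>k. (real k + 1) ^ d * \<rho> ^ k) \<in> O(\<lambda>k. 1 / real k ^ 2)"
    using assms by real_asymp
qed

section \<open>Weighted sums of Bessel functions over the order\<close>

text \<open>With \<open>w = (2/a) z\<^bsup>a/2\<^esup>\<close>, split at \<open>w = 1\<close>. For \<open>w \<ge> 1\<close>, decay of degree \<open>d + 2\<close> in the order leaves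
the convergent series \<open>\<Sum>k. 1 / (k + 1)\<^sup>2\<close> at the price of \<open>w\<^bsup>d+3\<^esup>\<close>, that is of \<open>z\<^bsup>a(d+3)/2\<^esup>\<close>; here \<open>z\<close>
is bounded away from \<open>0\<close>, so that negative powers of \<open>z\<close> are harmless. For \<open>w < 1\<close> the leading
power \<open>(w/2)\<^bsup>2(k+l)/a\<^esup>\<close> is a constant times \<open>z\<^sup>l\<close>, which cancels the singular factor
\<open>z\<^bsup>-l\<^esup>\<close>, times a geometric sequence.\<close>
lemma Bessel_J_series_bound:
  fixes a l E :: real and d :: nat
  assumes a: "0 < a" and l: "0 \<le> l" and E: "0 \<le> E" "a * (real d + 3) / 2 - l \<le> E"
  shows "\<exists>C>0. \<forall>z>0.
    summable (\<lambda>k. (real k + 1) ^ d * \<bar>Bessel_J (2 * (real k + l) / a) (2 / a * z powr (a / 2))\<bar>) \<and>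
    z powr (- l) * (\<Sum>k. (real k + 1) ^ d * \<bar>Bessel_J (2 * (real k + l) / a) (2 / a * z powr (a / 2))\<bar>)
      \<le> C * (1 + z) powr E"
proof -
  define w where "w z = 2 / a * z powr (a / 2)" for z
  define t where "t z k = (real k + 1) ^ d * \<bar>Bessel_J (2 * (real k + l) / a) (w z)\<bar>" for z and k :: nat
  define e where "e = a * (real d + 3) / 2 - l"
  have w_pos: "0 < w z" if "0 < z" for z using that a by (simp add: w_def)
  have large: "\<exists>C>0. \<forall>z>0. 1 \<le> w z \<longrightarrow> summable (t z) \<and> z powr (- l) * suminf (t z) \<le> C * (1 + z) powr E"
  proof -
    obtain B where B: "B > 0"
      "\<And>\<nu> w. 0 \<le> \<nu> \<Longrightarrow> 1 \<le> w \<Longrightarrow> (1 + \<nu>) ^ (d + 2) * \<bar>Bessel_J \<nu> w\<bar> \<le> B * w ^ Suc (d + 2)"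
      using Bessel_J_order_decay[of "d + 2"] by blast
    define c where "c = min 1 (2 / a)"
    have c: "0 < c" "c \<le> 1" "c \<le> 2 / a" using a by (auto simp: c_def)
    have S: "summable (\<lambda>k. 1 / (real k + 1) ^ 2)"
      using inverse_power_summable[of 2, where 'a=real, THEN summable_Suc_iff[THEN iffD2]]
      by (simp add: inverse_eq_divide add.commute)
    define T where "T = (\<Sum>k. 1 / (real k + 1) ^ 2)"
    have T: "0 < T" unfolding T_def by (intro suminf_pos S) auto
    define z0 where "z0 = (a / 2) powr (2 / a)"
    define D where "D = B / c ^ (d + 2) * (2 / a) ^ (d + 3) * T * max 1 (z0 powr e)"
    have D: "0 < D" using B c a T by (simp add: D_def)
    have "summable (t z) \<and> z powr (- l) * suminf (t z) \<le> D * (1 + z) powr E"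
      if z: "0 < z" and w1: "1 \<le> w z" for z
    proof
      have le: "t z k \<le> B / c ^ (d + 2) * w z ^ (d + 3) * (1 / (real k + 1) ^ 2)" for k
      proof -
        define \<nu> where "\<nu> = 2 * (real k + l) / a"
        have \<nu>: "0 \<le> \<nu>" using a l by (simp add: \<nu>_def)
        have "c * (real k + 1) \<le> 1 + 2 / a * real k"
          using c mult_right_mono[of c "2 / a" "real k"] by (simp add: algebra_simps)
        also have "\<dots> \<le> 1 + \<nu>" using a l by (simp add: \<nu>_def field_simps)
        finally have "(c * (real k + 1)) ^ (d + 2) * \<bar>Bessel_J \<nu> (w z)\<bar> \<le> (1 + \<nu>) ^ (d + 2) * \<bar>Bessel_J \<nu> (w z)\<bar>"
          using c by (intro mult_right_mono power_mono) auto
        also have "\<dots> \<le> B * w z ^ Suc (d + 2)" by (rule B(2)[OF \<nu> w1])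
        finally have "c ^ (d + 2) * ((real k + 1) ^ 2 * t z k) \<le> B * w z ^ (d + 3)"
          by (simp add: power_mult_distrib power_add t_def \<nu>_def mult_ac eval_nat_numeral)
        then show ?thesis using c by (simp add: field_simps)
      qed
      have nn: "0 \<le> t z k" for k by (simp add: t_def)
      have sumr: "summable (\<lambda>k. B / c ^ (d + 2) * w z ^ (d + 3) * (1 / (real k + 1) ^ 2))"
        by (intro summable_mult S)
      show st: "summable (t z)"
        by (rule summable_comparison_test'[OF sumr, of 0]) (use le nn in auto)
      have "suminf (t z) \<le> B / c ^ (d + 2) * w z ^ (d + 3) * T"
        unfolding T_def suminf_mult[OF S, symmetric] by (intro suminf_le le st sumr)
      then have "z powr (- l) * suminf (t z) \<le> z powr (- l) * (B / c ^ (d + 2) * w z ^ (d + 3) * T)"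
        by (intro mult_left_mono) auto
      also have "w z ^ (d + 3) = (2 / a) ^ (d + 3) * z powr (a * (real d + 3) / 2)"
        using z by (simp add: w_def power_mult_distrib powr_powr powr_realpow[symmetric] field_simps)
      also have "z powr (- l) * (B / c ^ (d + 2) * ((2 / a) ^ (d + 3) * z powr (a * (real d + 3) / 2)) * T)
        = B / c ^ (d + 2) * (2 / a) ^ (d + 3) * T * (z powr (- l) * z powr (a * (real d + 3) / 2))"
        by (simp only: mult_ac)
      also have "z powr (- l) * z powr (a * (real d + 3) / 2) = z powr e"
        by (simp add: powr_add[symmetric] e_def)
      also have "B / c ^ (d + 2) * (2 / a) ^ (d + 3) * T * z powr e
        \<le> B / c ^ (d + 2) * (2 / a) ^ (d + 3) * T * (max 1 (z0 powr e) * (1 + z) powr E)"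
      proof (intro mult_left_mono)
        have one: "1 \<le> (1 + z) powr E" using z E by (intro ge_one_powr_ge_zero) auto
        \<comment> \<open>The condition \<open>w \<ge> 1\<close> says precisely that \<open>z \<ge> z0\<close>.\<close>
        have "a / 2 \<le> z powr (a / 2)" using w1 a by (simp add: w_def field_simps)
        then have "z0 \<le> (z powr (a / 2)) powr (2 / a)"
          unfolding z0_def using a by (intro powr_mono2) auto
        then have z0: "0 < z0" "z0 \<le> z" using a z by (auto simp: powr_powr z0_def)
        consider "1 \<le> z" | "z < 1" "0 \<le> e" | "z < 1" "e < 0" by linarith
        then have "z powr e \<le> max 1 (z0 powr e) \<or> z powr e \<le> (1 + z) powr E"
        proof cases
          case 1
          then have "z powr e \<le> z powr E" using E by (intro powr_mono) (auto simp: e_def)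
          also have "\<dots> \<le> (1 + z) powr E" using z E by (intro powr_mono2) auto
          finally show ?thesis by simp
        next
          case 2
          then show ?thesis using z by (intro disjI1 max.coboundedI1 powr_le1) auto
        next
          case 3
          then show ?thesis using z0 by (intro disjI1 max.coboundedI2 powr_mono2') auto
        qed
        then show "z powr e \<le> max 1 (z0 powr e) * (1 + z) powr E"
        proof
          assume "z powr e \<le> max 1 (z0 powr e)"
          then show ?thesis
            using one mult_mono[of "z powr e" "max 1 (z0 powr e)" 1 "(1 + z) powr E"] by simp
        next
          assume "z powr e \<le> (1 + z) powr E"
          then show ?thesis
            using mult_mono[of 1 "max 1 (z0 powr e)" "z powr e" "(1 + z) powr E"] by simp
        qed
      qed (use B c a T in auto)
      finally show "z powr (- l) * suminf (t z) \<le> D * (1 + z) powr E"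
        by (simp add: D_def mult_ac)
    qed
    with D show ?thesis by blast
  qed
  have small: "\<exists>C>0. \<forall>z>0. w z < 1 \<longrightarrow> summable (t z) \<and> z powr (- l) * suminf (t z) \<le> C * (1 + z) powr E"
  proof -
    obtain M :: real where M: "M > 0" "\<And>\<nu>. 0 \<le> \<nu> \<Longrightarrow> rGamma (\<nu> + 1) \<le> M"
      using rGamma_bounded by blast
    define \<rho> where "\<rho> = (1 / 2 :: real) powr (2 / a)"
    have "\<rho> < (1 / 2) powr 0" unfolding \<rho>_def using a by (intro powr_less_mono') auto
    then have \<rho>: "0 < \<rho>" "\<rho> < 1" by (auto simp: \<rho>_def)
    note S = summable_power_times_geometric[OF \<rho>, of d]
    define T where "T = (\<Sum>k. (real k + 1) ^ d * \<rho> ^ k)"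
    have T: "0 < T" unfolding T_def using \<rho> by (intro suminf_pos S) auto
    define D where "D = M * exp 1 * (1 / a) powr (2 * l / a) * T"
    have D: "0 < D" using M a T by (simp add: D_def)
    have "summable (t z) \<and> z powr (- l) * suminf (t z) \<le> D * (1 + z) powr E"
      if z: "0 < z" and w1: "w z < 1" for z
    proof
      define F where "F = M * exp 1 * ((1 / a) powr (2 * l / a) * z powr l)"
      have le: "t z k \<le> F * ((real k + 1) ^ d * \<rho> ^ k)" for k
      proof -
        define \<nu> where "\<nu> = 2 * (real k + l) / a"
        have \<nu>: "0 \<le> \<nu>" using a l by (simp add: \<nu>_def)
        have "(w z / 2)\<^sup>2 \<le> 1"
          using w_pos[OF z] w1 by (intro power_le_one) auto
        then have "\<bar>Bessel_J \<nu> (w z)\<bar> \<le> M * exp 1 * (w z / 2) powr \<nu>"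
          using M \<nu> w_pos[OF z]
          by (intro order_trans[OF abs_Bessel_J_le_small_argument[OF \<nu> w_pos[OF z]]] mult_mono) auto
        also have "(w z / 2) powr \<nu> = (w z / 2) powr (2 * l / a) * ((w z / 2) powr (2 / a)) ^ k"
          using w_pos[OF z] a
          by (simp add: powr_realpow[symmetric] powr_powr powr_add[symmetric] \<nu>_def field_simps)
        also have "(w z / 2) powr (2 * l / a) = (1 / a) powr (2 * l / a) * z powr l"
          using a z by (simp add: w_def powr_mult powr_powr powr_divide)
        also have "M * exp 1 * ((1 / a) powr (2 * l / a) * z powr l * ((w z / 2) powr (2 / a)) ^ k)
          \<le> M * exp 1 * ((1 / a) powr (2 * l / a) * z powr l * \<rho> ^ k)"
          unfolding \<rho>_def using M w_pos[OF z] w1 a by (intro mult_left_mono power_mono powr_mono2) auto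
        finally have "\<bar>Bessel_J \<nu> (w z)\<bar> \<le> F * \<rho> ^ k"
          by (simp add: F_def mult_ac)
        then have "(real k + 1) ^ d * \<bar>Bessel_J \<nu> (w z)\<bar> \<le> (real k + 1) ^ d * (F * \<rho> ^ k)"
          by (intro mult_left_mono) auto
        then show ?thesis by (simp add: t_def \<nu>_def mult_ac)
      qed
      have nn: "0 \<le> t z k" for k by (simp add: t_def)
      have sumr: "summable (\<lambda>k. F * ((real k + 1) ^ d * \<rho> ^ k))"
        by (intro summable_mult S)
      show st: "summable (t z)"
        by (rule summable_comparison_test'[OF sumr, of 0]) (use le nn in auto)
      have "suminf (t z) \<le> F * T"
        unfolding T_def suminf_mult[OF S, symmetric] by (intro suminf_le le st sumr)
      then have "z powr (- l) * suminf (t z) \<le> z powr (- l) * (F * T)"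
        by (intro mult_left_mono) auto
      also have "\<dots> = D * (z powr (- l) * z powr l)" by (simp add: F_def D_def)
      also have "\<dots> = D * 1" using z by (simp add: powr_add[symmetric])
      also have "\<dots> \<le> D * (1 + z) powr E"
        using D z E by (intro mult_left_mono ge_one_powr_ge_zero) auto
      finally show "z powr (- l) * suminf (t z) \<le> D * (1 + z) powr E" .
    qed
    with D show ?thesis by blast
  qed
  obtain C1 where C1: "C1 > 0"
    "\<And>z. 0 < z \<Longrightarrow> 1 \<le> w z \<Longrightarrow> summable (t z) \<and> z powr (- l) * suminf (t z) \<le> C1 * (1 + z) powr E"
    using large by blast
  obtain C2 where C2: "C2 > 0"
    "\<And>z. 0 < z \<Longrightarrow> w z < 1 \<Longrightarrow> summable (t z) \<and> z powr (- l) * suminf (t z) \<le> C2 * (1 + z) powr E"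
    using small by blast
  have "summable (t z) \<and> z powr (- l) * suminf (t z) \<le> (C1 + C2) * (1 + z) powr E" if z: "0 < z" for z
  proof (cases "1 \<le> w z")
    case True
    have "C1 * (1 + z) powr E \<le> (C1 + C2) * (1 + z) powr E"
      using C2 by (intro mult_right_mono) auto
    with C1(2)[OF z True] show ?thesis by linarith
  next
    case False
    have "C2 * (1 + z) powr E \<le> (C1 + C2) * (1 + z) powr E"
      using C1 by (intro mult_right_mono) auto
    with C2(2)[OF z] False show ?thesis by force
  qed
  moreover have "C1 + C2 > 0" using C1 C2 by simp
  ultimately show ?thesis unfolding t_def w_def by blast
qed

section \<open>Gegenbauer polynomials with integer parameter\<close>

text \<open>The coefficients satisfy the same relation; after division by common factors it is
\<open>(k + 2) + l = (k + 2 - j + l) + j\<close>, where the last \<open>j\<close> turns \<open>1 / j!\<close> into \<open>1 / (j - 1)!\<close> and produces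
the polynomial of degree \<open>k\<close>. Reading the relation as a recurrence in steps of two raises the
parameter without loss of control over the growth in the degree.\<close>
lemma Gegenbauer_raise:
  assumes "0 < l"
  shows "Gegenbauer (Suc (Suc k)) (l + 1) t
    = Gegenbauer k (l + 1) t + (real (Suc (Suc k)) + l) / l * Gegenbauer (Suc (Suc k)) l t"
proof -
  define T where "T j = (2 * t) ^ (Suc (Suc k) - 2 * j)" for j
  have poch: "pochhammer l (Suc n) = l * pochhammer (l + 1) n" for n
    by (rule pochhammer_rec)
  have shift: "Gegenbauer k (l + 1) t = (\<Sum>j\<le>k div 2. (-1) ^ j * pochhammer (l + 1) (k - j)
      / (fact j * fact (k - 2 * j)) * T (Suc j))"
    by (simp add: Gegenbauer_def T_def)
  have step: "(-1) ^ Suc j * pochhammer (l + 1) (Suc (Suc k) - Suc j)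
        / (fact (Suc j) * fact (Suc (Suc k) - 2 * Suc j)) * T (Suc j)
     = (-1) ^ j * pochhammer (l + 1) (k - j) / (fact j * fact (k - 2 * j)) * T (Suc j)
     + (real (Suc (Suc k)) + l) / l * ((-1) ^ Suc j * pochhammer l (Suc (Suc k) - Suc j)
        / (fact (Suc j) * fact (Suc (Suc k) - 2 * Suc j)) * T (Suc j))"
    if "j \<le> k div 2" for j
  proof -
    have jk: "j \<le> k" using that by simp
    define P where "P = pochhammer (l + 1) (k - j)"
    define F where "F = (fact (k - 2 * j) :: real)"
    define G where "G = (fact j :: real)"
    have e: "Suc (Suc k) - Suc j = Suc (k - j)" "Suc (Suc k) - 2 * Suc j = k - 2 * j"
      using jk by auto
    have p1: "pochhammer (l + 1) (Suc (k - j)) = P * (l + 1 + (real k - real j))"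
      using jk by (simp add: pochhammer_Suc P_def of_nat_diff)
    have p2: "pochhammer l (Suc (k - j)) = l * P"
      unfolding P_def by (rule poch)
    have G: "(fact (Suc j) :: real) = (real j + 1) * G"
      by (simp add: G_def)
    have "F > 0" "G > 0" by (auto simp: F_def G_def)
    then show ?thesis
      unfolding e p1 p2 G P_def[symmetric] F_def[symmetric] G_def[symmetric]
      using assms by (simp add: divide_simps) (simp add: algebra_simps)
  qed
  have zero: "(-1) ^ 0 * pochhammer (l + 1) (Suc (Suc k) - 0)
        / (fact 0 * fact (Suc (Suc k) - 2 * 0)) * T 0
     = (real (Suc (Suc k)) + l) / l * ((-1) ^ 0 * pochhammer l (Suc (Suc k) - 0)
        / (fact 0 * fact (Suc (Suc k) - 2 * 0)) * T 0)"
    using assms by (simp add: poch) (simp add: pochhammer_Suc divide_simps algebra_simps)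
  define A where "A j = (-1) ^ j * pochhammer (l + 1) (Suc (Suc k) - j)
      / (fact j * fact (Suc (Suc k) - 2 * j)) * T j" for j
  define B where "B j = (real (Suc (Suc k)) + l) / l * ((-1) ^ j * pochhammer l (Suc (Suc k) - j)
      / (fact j * fact (Suc (Suc k) - 2 * j)) * T j)" for j
  have "Gegenbauer (Suc (Suc k)) (l + 1) t = (\<Sum>j\<le>Suc (k div 2). A j)"
    by (simp add: Gegenbauer_def A_def T_def)
  also have "\<dots> = A 0 + (\<Sum>j\<le>k div 2. A (Suc j))"
    by (rule sum.atMost_Suc_shift)
  also have "\<dots> = B 0 + (Gegenbauer k (l + 1) t + (\<Sum>j\<le>k div 2. B (Suc j)))"
    unfolding shift sum.distrib[symmetric]
    using zero step by (intro arg_cong2[of _ _ _ _ "(+)"] sum.cong) (auto simp: A_def B_def)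
  also have "\<dots> = Gegenbauer k (l + 1) t + (\<Sum>j\<le>Suc (k div 2). B j)"
    by (simp only: sum.atMost_Suc_shift add_ac)
  also have "(\<Sum>j\<le>Suc (k div 2). B j) = (real (Suc (Suc k)) + l) / l * Gegenbauer (Suc (Suc k)) l t"
    unfolding Gegenbauer_def B_def T_def sum_distrib_left by (simp only: div2_Suc_Suc)
  finally show ?thesis .
qed

text \<open>For parameter \<open>1\<close> (Chebyshev polynomials of the second kind) the coefficients are binomial, and
they vanish beyond \<open>k div 2\<close>; the longer range of summation avoids a case distinction on the
parity of \<open>k\<close>.\<close>
lemma Gegenbauer_one_binomial:
  "Gegenbauer k 1 t = (\<Sum>j\<le>k. (-1) ^ j * real ((k - j) choose j) * (2 * t) ^ (k - 2 * j))"
proof -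
  have "Gegenbauer k 1 t = (\<Sum>j\<le>k div 2. (-1) ^ j * real ((k - j) choose j) * (2 * t) ^ (k - 2 * j))"
    unfolding Gegenbauer_def
  proof (intro sum.cong refl)
    fix j assume "j \<in> {..k div 2}"
    then have "j \<le> k - j" by auto
    then have "real ((k - j) choose j) = fact (k - j) / (fact j * fact (k - j - j))"
      by (rule binomial_fact)
    moreover have "k - j - j = k - 2 * j" by simp
    ultimately show "(-1) ^ j * pochhammer 1 (k - j) / (fact j * fact (k - 2 * j)) * (2 * t) ^ (k - 2 * j)
      = (-1) ^ j * real ((k - j) choose j) * (2 * t) ^ (k - 2 * j)"
      by (simp add: pochhammer_fact[symmetric])
  qed
  also have "\<dots> = (\<Sum>j\<le>k. (-1) ^ j * real ((k - j) choose j) * (2 * t) ^ (k - 2 * j))"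
    by (intro sum.mono_neutral_left) (auto simp: binomial_eq_0)
  finally show ?thesis .
qed

text \<open>Pascal's rule for the coefficients.\<close>
lemma Gegenbauer_one_recurrence:
  "Gegenbauer (Suc (Suc k)) 1 t = 2 * t * Gegenbauer (Suc k) 1 t - Gegenbauer k 1 t"
proof -
  define B where "B n j = (-1) ^ j * real ((n - j) choose j) * (2 * t) ^ (n - 2 * j)" for n j :: nat
  have step: "B (Suc (Suc k)) (Suc j) = 2 * t * B (Suc k) (Suc j) - B k j" if "j \<le> k" for j
  \<comment> \<open>For \<open>2 * j \<ge> k\<close> the exponents are truncated, but the coefficients all vanish or \<open>k = 2 * j\<close>.\<close>
  proof (cases "2 * j < k")
    case True
    then have "Suc (Suc k) - 2 * Suc j = Suc (Suc k - 2 * Suc j)" "k - 2 * j = Suc (Suc k - 2 * Suc j)"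
      by auto
    then have pw: "(2 * t) ^ (Suc (Suc k) - 2 * Suc j) = 2 * t * (2 * t) ^ (Suc k - 2 * Suc j)"
      "(2 * t) ^ (k - 2 * j) = 2 * t * (2 * t) ^ (Suc k - 2 * Suc j)"
      by (metis power_Suc)+
    have "Suc (Suc k) - Suc j = Suc (k - j)" "Suc k - Suc j = k - j" using that by auto
    then have bin: "real ((Suc (Suc k) - Suc j) choose Suc j) = real ((k - j) choose j) + real ((Suc k - Suc j) choose Suc j)"
      by simp
    show ?thesis unfolding B_def pw bin by (simp add: algebra_simps)
  next
    case False
    then have "Suc k - Suc j < Suc j \<or> k = 2 * j" "Suc (Suc k) - Suc j = Suc (k - j)" "Suc k - Suc j = k - j"
      using that by auto
    with False show ?thesis
      by (auto simp: B_def binomial_eq_0)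
  qed
  have zero: "B (Suc (Suc k)) 0 = 2 * t * B (Suc k) 0"
    by (simp add: B_def)
  have last: "B (Suc (Suc k)) (Suc (Suc k)) = 0" by (simp add: B_def)
  have G: "Gegenbauer n 1 t = (\<Sum>j\<le>n. B n j)" for n
    unfolding B_def by (rule Gegenbauer_one_binomial)
  have "Gegenbauer (Suc (Suc k)) 1 t = (\<Sum>j\<le>Suc k. B (Suc (Suc k)) j)"
    unfolding G by (subst sum.atMost_Suc) (simp add: last)
  also have "\<dots> = 2 * t * B (Suc k) 0 + (\<Sum>j\<le>k. 2 * t * B (Suc k) (Suc j) - B k j)"
    by (simp only: sum.atMost_Suc_shift zero) (intro arg_cong2[of _ _ _ _ plus] refl sum.cong, simp add: step)
  also have "\<dots> = 2 * t * Gegenbauer (Suc k) 1 t - Gegenbauer k 1 t"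
    unfolding G sum.atMost_Suc_shift by (simp add: sum_subtractf sum_distrib_left distrib_left)
  finally show ?thesis .
qed

lemma Gegenbauer_0: "Gegenbauer 0 l t = 1"
  by (simp add: Gegenbauer_def)

lemma Gegenbauer_Suc_0: "Gegenbauer (Suc 0) l t = 2 * l * t"
  by (simp add: Gegenbauer_def)

text \<open>The quadratic form \<open>U\<^bsub>k+1\<^esub>\<^sup>2 - 2t U\<^bsub>k+1\<^esub> U\<^sub>k + U\<^sub>k\<^sup>2\<close> is invariant under the three-term recurrence and
equals \<open>1\<close>. Completing the square for \<open>\<bar>t\<bar> \<le> 1\<close> gives \<open>\<bar>U\<^bsub>k+1\<^esub> - t U\<^sub>k\<bar> \<le> 1\<close>, so the absolute value grows
by at most \<open>1\<close> in each step.\<close>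
lemma abs_Gegenbauer_one_le:
  assumes "\<bar>t\<bar> \<le> 1"
  shows "\<bar>Gegenbauer k 1 t\<bar> \<le> real k + 1"
proof (induction k)
  case (Suc k)
  define U where "U = (\<lambda>k. Gegenbauer k 1 t)"
  have inv: "(U (Suc k))\<^sup>2 - 2 * t * U (Suc k) * U k + (U k)\<^sup>2 = 1" for k
  proof (induction k)
    case (Suc k)
    have rec: "U (Suc (Suc k)) = 2 * t * U (Suc k) - U k"
      unfolding U_def by (rule Gegenbauer_one_recurrence)
    show ?case using Suc unfolding rec by (simp add: power2_eq_square algebra_simps)
  qed (simp add: U_def Gegenbauer_0 Gegenbauer_Suc_0 power2_eq_square)
  have "t\<^sup>2 \<le> 1" using assms by (simp add: abs_square_le_1)
  then have "0 \<le> (1 - t\<^sup>2) * (U k)\<^sup>2" by (intro mult_nonneg_nonneg) auto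
  moreover have "(U (Suc k) - t * U k)\<^sup>2 + (1 - t\<^sup>2) * (U k)\<^sup>2 = 1"
    using inv[of k] by (simp add: power2_eq_square algebra_simps)
  ultimately have "\<bar>U (Suc k) - t * U k\<bar> \<le> 1"
    by (simp add: abs_square_le_1[symmetric])
  moreover have "\<bar>t * U k\<bar> \<le> 1 * \<bar>U k\<bar>"
    unfolding abs_mult using assms by (intro mult_right_mono) auto
  ultimately have "\<bar>U (Suc k)\<bar> \<le> \<bar>U k\<bar> + 1" by linarith
  with Suc show ?case by (simp add: U_def)
qed (simp add: Gegenbauer_0)

text \<open>Induction on the parameter: by the raising relation the polynomial with parameter \<open>n + 1\<close> of degree
\<open>k\<close> is a sum of about \<open>k/2\<close> polynomials with parameter \<open>n\<close> and weights of size at most \<open>k + 1\<close>,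
which costs two powers.\<close>
lemma Gegenbauer_bound:
  assumes "0 < n"
  shows "\<exists>C>0. \<forall>k t. \<bar>t\<bar> \<le> 1 \<longrightarrow> \<bar>Gegenbauer k (real n) t\<bar> \<le> C * (real k + 1) ^ (2 * n - 1)"
  using assms
proof (induction n rule: nat_induct_non_zero)
  case 1
  show ?case using abs_Gegenbauer_one_le by (intro exI[of _ 1]) simp
next
  case (Suc n)
  then obtain C where C: "C > 0" "\<And>k t. \<bar>t\<bar> \<le> 1 \<Longrightarrow> \<bar>Gegenbauer k (real n) t\<bar> \<le> C * (real k + 1) ^ (2 * n - 1)"
    by blast
  define D where "D = max (2 * C) (2 * (real n + 1))"
  have D: "2 * C \<le> D" "2 * (real n + 1) \<le> D" "0 < D" by (auto simp: D_def)
  have exp_eq: "2 * Suc n - 1 = Suc (Suc (2 * n - 1))" using Suc by simp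
  have "\<bar>Gegenbauer k (real (Suc n)) t\<bar> \<le> D * (real k + 1) ^ (2 * Suc n - 1)" if t: "\<bar>t\<bar> \<le> 1" for k t
  proof (induction k rule: induct_nat_012)
    case 0
    show ?case using D by (simp add: Gegenbauer_0)
  next
    case 1
    have "\<bar>Gegenbauer (Suc 0) (real (Suc n)) t\<bar> = 2 * (real n + 1) * \<bar>t\<bar>"
      by (simp add: Gegenbauer_Suc_0 abs_mult)
    also have "\<dots> \<le> D * 1" using D t by (intro mult_mono) auto
    also have "\<dots> \<le> D * (real (Suc 0) + 1) ^ (2 * Suc n - 1)"
      using D by (intro mult_left_mono one_le_power) auto
    finally show ?case .
  next
    case (ge2 k)
    \<comment> \<open>With \<open>x = k + 3\<close>, the induction closes because \<open>(x - 2) x\<^bsup>e+1\<^esup> + 2 x\<^bsup>e+1\<^esup> = x\<^bsup>e+2\<^esup>\<close>.\<close>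
    define e where "e = 2 * n - 1"
    define x where "x = real (Suc (Suc k)) + 1"
    have x: "1 \<le> x" "real k + 1 = x - 2" "2 \<le> x" by (auto simp: x_def)
    have "(real (Suc (Suc k)) + real n) / real n = 1 + real (Suc (Suc k)) / real n"
      using Suc by (simp add: divide_simps)
    also have "\<dots> \<le> 1 + real (Suc (Suc k))"
      using Suc frac_le[of "real (Suc (Suc k))" "real (Suc (Suc k))" 1 "real n"] by simp
    finally have fac: "(real (Suc (Suc k)) + real n) / real n \<le> x" by (simp add: x_def)
    have "\<bar>Gegenbauer (Suc (Suc k)) (real (Suc n)) t\<bar>
       \<le> \<bar>Gegenbauer k (real (Suc n)) t\<bar> + (real (Suc (Suc k)) + real n) / real n * \<bar>Gegenbauer (Suc (Suc k)) (real n) t\<bar>"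
    proof -
      have "Gegenbauer (Suc (Suc k)) (real (Suc n)) t = Gegenbauer k (real (Suc n)) t
         + (real (Suc (Suc k)) + real n) / real n * Gegenbauer (Suc (Suc k)) (real n) t"
        using Gegenbauer_raise[of "real n" k t] Suc by (simp add: add.commute)
      moreover have "\<bar>(real (Suc (Suc k)) + real n) / real n * Gegenbauer (Suc (Suc k)) (real n) t\<bar>
        = (real (Suc (Suc k)) + real n) / real n * \<bar>Gegenbauer (Suc (Suc k)) (real n) t\<bar>"
        by (simp add: abs_mult)
      ultimately show ?thesis by (metis abs_triangle_ineq)
    qed
    also have "\<dots> \<le> D * (x - 2) ^ Suc (Suc e) + x * (C * x ^ e)"
      using ge2 C(2)[OF t, of "Suc (Suc k)"] fac x
      unfolding exp_eq e_def[symmetric] x(2) x_def[symmetric]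
      by (intro add_mono mult_mono) auto
    also have "\<dots> \<le> D * ((x - 2) * x ^ Suc e) + D * (2 * x ^ Suc e)"
    proof (intro add_mono)
      show "D * (x - 2) ^ Suc (Suc e) \<le> D * ((x - 2) * x ^ Suc e)"
        using D x unfolding power_Suc[of "x - 2" "Suc e"] by (intro mult_left_mono power_mono) auto
      show "x * (C * x ^ e) \<le> D * (2 * x ^ Suc e)"
        using D C(1) x mult_right_mono[of C "2 * D" "x ^ Suc e"] by (simp add: mult_ac)
    qed
    also have "\<dots> = D * x ^ Suc (Suc e)" by (simp add: algebra_simps)
    finally show ?case unfolding exp_eq e_def[symmetric] x_def[symmetric] .
  qed
  with D(3) show ?case by blast
qed

section \<open>The kernel\<close>

text \<open>In the plane the angular factors are bounded by \<open>1\<close>, and the term of order \<open>0\<close> is the head of the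
same series: the sum estimate applies with \<open>l = 0\<close> and weight exponent \<open>d = 0\<close>.\<close>
lemma deformed_Fourier_kernel_bound_plane:
  fixes a E :: real
  assumes a: "0 < a" and card: "CARD('n::finite) = 2" and E: "0 \<le> E" "a * 3 / 2 \<le> E"
  shows "\<exists>C>0. \<forall>x y :: real ^ 'n. norm (deformed_Fourier_kernel a x y) \<le> C * (1 + norm x * norm y) powr E"
proof -
  define w where "w z = 2 / a * z powr (a / 2)" for z
  define J where "J z k = \<bar>Bessel_J (2 * real k / a) (w z)\<bar>" for z and k :: nat
  obtain C where C: "C > 0" "\<And>z. 0 < z \<Longrightarrow> summable (J z) \<and> suminf (J z) \<le> C * (1 + z) powr E"
  proof -
    have "\<exists>C>0. \<forall>z>0. summable (J z) \<and> z powr (- 0) * suminf (J z) \<le> C * (1 + z) powr E"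
      using Bessel_J_series_bound[OF a order_refl E(1), of 0] E(2) by (simp add: J_def [abs_def] w_def)
    then show ?thesis using that by auto
  qed
  have "norm (deformed_Fourier_kernel a x y) \<le> (2 * C + 1) * (1 + norm x * norm y) powr E" for x y :: "real ^ 'n"
  proof (cases "x = 0 \<or> y = 0")
    case True
    then show ?thesis using C(1) by (auto simp: deformed_Fourier_kernel_def Let_def)
  next
    case False
    define z where "z = norm x * norm y"
    define \<theta> where "\<theta> = arccos ((x \<bullet> y) / z)"
    have z: "0 < z" using False by (simp add: z_def)
    define f where "f k = exp (- (\<i> * pi * real (Suc k) / a))
        * of_real (Bessel_J (2 * real (Suc k) / a) (w z) * cos (real (Suc k) * \<theta>))" for k
    have K: "deformed_Fourier_kernel a x y = of_real (Bessel_J 0 (w z)) + 2 * suminf f"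
      using False card by (simp add: deformed_Fourier_kernel_def Let_def z_def \<theta>_def w_def f_def [abs_def])
    have f_le: "norm (f k) \<le> J z (Suc k)" for k
      by (simp add: f_def J_def norm_mult abs_mult mult_left_le)
    have SJ: "summable (J z)" using C(2)[OF z] by simp
    then have SJ': "summable (\<lambda>k. J z (Suc k))" by (simp add: summable_Suc_iff)
    have Sf: "summable (\<lambda>k. norm (f k))"
      by (rule summable_comparison_test'[OF SJ', of 0]) (use f_le in auto)
    have "norm (suminf f) \<le> (\<Sum>k. norm (f k))" by (rule summable_norm[OF Sf])
    also have "\<dots> \<le> (\<Sum>k. J z (Suc k))" by (intro suminf_le f_le Sf SJ')
    also have "\<dots> = suminf (J z) - J z 0" by (rule suminf_split_head[OF SJ])
    finally have "norm (suminf f) \<le> suminf (J z) - J z 0" .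
    moreover have "norm (deformed_Fourier_kernel a x y) \<le> J z 0 + 2 * norm (suminf f)"
      unfolding K by (rule order_trans[OF norm_triangle_ineq]) (simp add: J_def norm_mult)
    moreover have "0 \<le> J z 0" by (simp add: J_def)
    ultimately have "norm (deformed_Fourier_kernel a x y) \<le> 2 * suminf (J z)" by linarith
    also have "\<dots> \<le> 2 * (C * (1 + z) powr E)" using C(2)[OF z] by simp
    also have "\<dots> \<le> (2 * C + 1) * (1 + z) powr E" by (simp add: algebra_simps)
    finally show ?thesis by (simp add: z_def)
  qed
  then show ?thesis using C(1) by (intro exI[of _ "2 * C + 1"]) auto
qed

text \<open>Here \<open>\<lambda> = n\<close>. The weight \<open>(\<lambda> + k) / \<lambda> \<le> k + 1\<close> and the bound of degree \<open>2n - 1\<close> for the Gegenbauer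
polynomial combine to the weight exponent \<open>d = 2n\<close> in the sum estimate.\<close>
lemma deformed_Fourier_kernel_bound_higher:
  fixes a E :: real
  assumes a: "0 < a" and n: "0 < n" and card: "CARD('n::finite) = 2 * n + 2"
    and E: "0 \<le> E" "a * (2 * real n + 3) / 2 - real n \<le> E"
  shows "\<exists>C>0. \<forall>x y :: real ^ 'n. norm (deformed_Fourier_kernel a x y) \<le> C * (1 + norm x * norm y) powr E"
proof -
  define l where "l = real n"
  have l: "1 \<le> l" using n by (simp add: l_def)
  define w where "w z = 2 / a * z powr (a / 2)" for z
  define J where "J z k = (real k + 1) ^ (2 * n) * \<bar>Bessel_J (2 * (real k + l) / a) (w z)\<bar>" for z and k :: nat
  obtain B where B: "B > 0" "\<And>z. 0 < z \<Longrightarrow> summable (J z) \<and> z powr (- l) * suminf (J z) \<le> B * (1 + z) powr E"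
    using Bessel_J_series_bound[of a l E "2 * n"] a l E unfolding J_def w_def l_def by auto
  obtain G where G: "G > 0" "\<And>k t. \<bar>t\<bar> \<le> 1 \<Longrightarrow> \<bar>Gegenbauer k l t\<bar> \<le> G * (real k + 1) ^ (2 * n - 1)"
    using Gegenbauer_bound[OF n] unfolding l_def by blast
  define A where "A = a powr (2 * l / a) * Gamma ((2 * l + a) / a)"
  have A: "0 < A"
    unfolding A_def using a l by (intro mult_pos_pos Gamma_real_pos divide_pos_pos) auto
  define C where "C = A * G * B + 1"
  have C: "0 < C" using A G B by (simp add: C_def add_pos_pos)
  have "norm (deformed_Fourier_kernel a x y) \<le> C * (1 + norm x * norm y) powr E" for x y :: "real ^ 'n"
  proof (cases "x = 0 \<or> y = 0")
    case True
    then show ?thesis using A G B by (auto simp: deformed_Fourier_kernel_def Let_def C_def)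
  next
    case False
    define z where "z = norm x * norm y"
    define \<xi> where "\<xi> = (x \<bullet> y) / z"
    have z: "0 < z" using False by (simp add: z_def)
    have \<xi>: "\<bar>\<xi>\<bar> \<le> 1"
      using z Cauchy_Schwarz_ineq2[of x y] by (simp add: \<xi>_def z_def)
    have l_eq: "(real CARD('n) - 2) / 2 = l" by (simp add: card l_def)
    have card2: "CARD('n) \<noteq> 2" using card n by simp
    define f where "f k = exp (- (\<i> * pi * real k / a)) * of_real ((l + real k) / l * z powr (- l)
        * Bessel_J (2 * (real k + l) / a) (w z) * Gegenbauer k l \<xi>)" for k
    have K: "deformed_Fourier_kernel a x y = of_real A * suminf f"
      unfolding deformed_Fourier_kernel_def Let_def l_eq
      using False card2 by (simp add: z_def \<xi>_def w_def f_def [abs_def] A_def)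
    have f_le: "norm (f k) \<le> G * z powr (- l) * J z k" for k
    proof -
      have "(l + real k) / l = 1 + real k / l" using l by (simp add: add_divide_distrib)
      also have "\<dots> \<le> real k + 1" using l frac_le[of "real k" "real k" 1 l] by simp
      finally have fac: "(l + real k) / l \<le> real k + 1" .
      have "2 * n = Suc (2 * n - 1)" using n by simp
      then have pw: "(real k + 1) ^ (2 * n) = (real k + 1) * (real k + 1) ^ (2 * n - 1)"
        by (metis power_Suc)
      have "norm (f k) = (l + real k) / l * z powr (- l)
        * \<bar>Bessel_J (2 * (real k + l) / a) (w z)\<bar> * \<bar>Gegenbauer k l \<xi>\<bar>"
      proof -
        have "norm (exp (- (\<i> * pi * real k / a))) = 1" by simp
        then show ?thesis
          unfolding f_def norm_mult norm_of_real abs_mult using l by simp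
      qed
      also have "\<dots> \<le> (real k + 1) * z powr (- l)
        * \<bar>Bessel_J (2 * (real k + l) / a) (w z)\<bar> * (G * (real k + 1) ^ (2 * n - 1))"
        by (rule mult_mono[OF mult_right_mono[OF mult_right_mono[OF fac]] G(2)[OF \<xi>]]) auto
      also have "\<dots> = G * z powr (- l) * J z k"
        unfolding J_def pw by (simp only: mult_ac)
      finally show ?thesis .
    qed
    have SJ: "summable (J z)" using B(2)[OF z] by simp
    then have SJ': "summable (\<lambda>k. G * z powr (- l) * J z k)" by (rule summable_mult)
    have Sf: "summable (\<lambda>k. norm (f k))"
      by (rule summable_comparison_test'[OF SJ', of 0]) (use f_le in auto)
    have "norm (suminf f) \<le> (\<Sum>k. norm (f k))" by (rule summable_norm[OF Sf])
    also have "\<dots> \<le> (\<Sum>k. G * z powr (- l) * J z k)" by (intro suminf_le f_le Sf SJ')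
    also have "\<dots> = G * (z powr (- l) * suminf (J z))"
      unfolding mult.assoc[symmetric] by (rule suminf_mult[OF SJ])
    also have "\<dots> \<le> G * (B * (1 + z) powr E)"
      using B(2)[OF z] G(1) by (intro mult_left_mono) auto
    finally have "norm (suminf f) \<le> G * (B * (1 + z) powr E)" .
    then have "norm (deformed_Fourier_kernel a x y) \<le> A * (G * (B * (1 + z) powr E))"
      unfolding K norm_mult using A by (simp add: mult_left_mono)
    also have "\<dots> \<le> C * (1 + z) powr E" by (simp add: C_def algebra_simps)
    finally show ?thesis by (simp add: z_def)
  qed
  with C show ?thesis by blast
qed

theorem theorem3p3:
  fixes p q m :: nat
  assumes "p > 0" and "q > 0"
    and "m \<ge> 2" and "even m" and "CARD('n::finite) = m"
  shows "\<exists>C>0. \<forall>x y :: real ^ 'n.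
           norm (deformed_Fourier_kernel (real p / real q) x y)
             \<le> C * (1 + norm x * norm y) powr (3 * real m * real p / 2 - real m + 2)"
proof -
  define a where "a = real p / real q"
  define E where "E = 3 * real m * real p / 2 - real m + 2"
  have a: "0 < a" "a \<le> real p"
    using assms frac_le[of "real p" "real p" 1 "real q"] by (auto simp: a_def)
  \<comment> \<open>Both cases need the exponent \<open>a(m+1)/2 - (m-2)/2\<close>, which is at most \<open>E\<close> because \<open>a \<le> p\<close>,
    \<open>m \<le> mp\<close> and \<open>2p \<le> mp\<close>.\<close>
  define X where "X = real m * real p"
  have E_eq: "E = 3 * X / 2 - real m + 2" by (simp add: E_def X_def)
  have "real m * 1 \<le> X" unfolding X_def using assms by (intro mult_left_mono) auto
  then have mX: "real m \<le> X" by simp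
  have E0: "0 \<le> E" using mX by (simp add: E_eq)
  have "a * (real m + 1) \<le> real p * (real m + 1)" using a by (intro mult_right_mono) auto
  also have "\<dots> = X + real p" by (simp add: X_def algebra_simps)
  finally have Y: "a * (real m + 1) \<le> X + real p" .
  have pX: "real p * 2 \<le> X"
    unfolding X_def using assms by (subst mult.commute) (intro mult_right_mono, auto)
  have "Y / 2 - (real m - 2) / 2 \<le> E" if "Y \<le> X + real p" for Y
    using that pX mX by (simp add: E_eq field_simps)
  from this[OF Y] have E1: "a * (real m + 1) / 2 - (real m - 2) / 2 \<le> E" .
  show ?thesis
  proof (cases "m = 2")
    case True
    then have "\<exists>C>0. \<forall>x y :: real ^ 'n. norm (deformed_Fourier_kernel a x y) \<le> C * (1 + norm x * norm y) powr E"
      using assms a E0 E1 by (intro deformed_Fourier_kernel_bound_plane) auto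
    then show ?thesis by (simp add: a_def E_def)
  next
    case False
    obtain n where n: "m = 2 * n + 2"
    proof -
      obtain k where "m = 2 * k" using assms by (elim evenE)
      then show ?thesis using assms that[of "k - 1"] by simp
    qed
    have E2: "a * (2 * real n + 3) / 2 - real n \<le> E" using E1 n by (simp add: add.commute)
    have "\<exists>C>0. \<forall>x y :: real ^ 'n. norm (deformed_Fourier_kernel a x y) \<le> C * (1 + norm x * norm y) powr E"
      using False assms(5) a E0 E2 n by (intro deformed_Fourier_kernel_bound_higher[of a n]) auto
    then show ?thesis by (simp add: a_def E_def)
  qed
qed

end
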